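(* Let $n\ge1$. The number of permutations $\pi$ of $\{1,\dots,n+1\}$ corresponding to smooth collections, i.e. satisfying for all $1\le a<b\le n$ $$\text{if } \pi^{-1}(b)\le a,\ \text{ then }\ \pi^{-1}(a+1)\le b,$$ is equal to the large Schr\"oder number $r_n$. The number of such permutations which moreover satisfy $\pi^{-1}(n+1)<\pi^{-1}(1)$ is equal to the small Schr\"oder number $s_n$.
   Context: A smooth collection (of length $n$) is a collection $\mathbf S=(S_1,\dots,S_n)$ of subsets of $\{1,\dots,n+1\}$ with $\#S_a=a$, $S_a\subset S_{a+1}$, and such that for all $1\le a<b\le n$, $b\in S_a$ implies $a+1\in S_b$. To a smooth collection one attaches the permutation $\pi$ of $\{1,\dots,n+1\}$ given by $\{\pi(m)\}=S_m\setminus S_{m-1}$ for $1\le m\le n+1$, where $S_0=\emptyset$ and $S_{n+1}=\{1,\dots,n+1\}$; the permutations corresponding to smooth collections are exactly those satisfying the displayed condition. The large Schr\"oder number $r_n$ is the number of Schr\"oder paths, i.e. lattice paths from $(0,0)$ to $(n,n)$ with steps $(1,0)$, $(0,1)$, $(1,1)$ which never go above the diagonal $y=x$. The small Schr\"oder number is $s_n=r_n/2$. *)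

theory Defs
  imports Main "HOL.Rat" "HOL-Library.Product_Plus" "HOL-Combinatorics.Permutations"
begin

text \<open>A collection of length \<open>n\<close> is a function of which only the values at \<open>1, \<dots>, n\<close> matter.\<close>

definition smooth_collection :: "nat \<Rightarrow> (nat \<Rightarrow> nat set) \<Rightarrow> bool" where
  "smooth_collection n S \<longleftrightarrow>
     (\<forall>a\<in>{1..n}. S a \<subseteq> {1..n+1} \<and> card (S a) = a) \<and>
     (\<forall>a\<in>{1..<n}. S a \<subset> S (a + 1)) \<and>
     (\<forall>a b. 1 \<le> a \<and> a < b \<and> b \<le> n \<longrightarrow> b \<in> S a \<longrightarrow> a + 1 \<in> S b)"

text \<open>The convention \<open>S\<^sub>0 = {}\<close> and \<open>S\<^sub>n\<^sub>+\<^sub>1 = {1, \<dots>, n+1}\<close>.\<close>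

definition extend_collection :: "nat \<Rightarrow> (nat \<Rightarrow> nat set) \<Rightarrow> nat \<Rightarrow> nat set" where
  "extend_collection n S m = (if m = 0 then {} else if m \<le> n then S m else {1..n+1})"

definition attached_perm :: "nat \<Rightarrow> (nat \<Rightarrow> nat set) \<Rightarrow> (nat \<Rightarrow> nat) \<Rightarrow> bool" where
  "attached_perm n S \<pi> \<longleftrightarrow>
     \<pi> permutes {1..n+1} \<and>
     (\<forall>m\<in>{1..n+1}. {\<pi> m} = extend_collection n S m - extend_collection n S (m - 1))"

definition smooth_perms :: "nat \<Rightarrow> (nat \<Rightarrow> nat) set" where
  "smooth_perms n = {\<pi>. \<exists>S. smooth_collection n S \<and> attached_perm n S \<pi>}"

text \<open>A path is given by its list of steps; its vertices are the partial sums. As the region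
  \<open>y \<le> x\<close> is convex, a path stays in it as soon as all its vertices do.\<close>

definition schroeder_paths :: "nat \<Rightarrow> (nat \<times> nat) list set" where
  "schroeder_paths n =
     {p. set p \<subseteq> {(1, 0), (0, 1), (1, 1)} \<and> sum_list p = (n, n) \<and>
         (\<forall>k\<le>length p. snd (sum_list (take k p)) \<le> fst (sum_list (take k p)))}"

definition large_schroeder :: "nat \<Rightarrow> nat" where
  "large_schroeder n = card (schroeder_paths n)"

text \<open>Rational-valued, so that \<open>r\<^sub>n / 2\<close> is exact division.\<close>

definition small_schroeder :: "nat \<Rightarrow> rat" where
  "small_schroeder n = of_nat (large_schroeder n) / 2"

end

theory Submission imports Defs begin

text \<open>
  A smooth collection is recovered from its permutation as \<open>S\<^sub>m = \<pi> ` {1..m}\<close>, so \<open>b \<in> S\<^sub>a\<close> means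
  \<open>\<pi>\<inverse> b \<le> a\<close>, and smoothness of the collection is literally the condition on \<open>\<pi>\<close>.

  For \<open>\<sigma> = \<pi>\<inverse>\<close> this condition says that there are no positions \<open>i < k\<close> with
  \<open>\<sigma> k < i\<close> and \<open>k < \<sigma> i\<close>: drawing an arc from every position to its value, no forward arc crosses
  a backward arc in such a way that the two sources lie between the two targets. In this form
  the condition makes sense for permutations of any interval \<open>{l..u}\<close>, and both counts follow from
  two observations.

  The first is a decomposition by the position \<open>j\<close> of the smallest value \<open>l\<close>. If \<open>j = l\<close>, this
  point can be dropped. If \<open>j > l\<close>, the arc from \<open>j\<close> back to \<open>l\<close> forces the positions strictly
  between \<open>l\<close> and \<open>j\<close> to take values in \<open>{l+1..j}\<close>, so that exactly one value \<open>w\<close> of that interval is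
  left for the other positions. Giving \<open>w\<close> to the position \<open>j\<close> yields a permutation \<open>\<tau>\<close> of
  \<open>{l+1..j}\<close>; collapsing \<open>w\<close>, and the position \<open>l\<close>, to the point \<open>j\<close> in the rest of the
  permutation yields a permutation \<open>\<rho>\<close> of \<open>{j..u}\<close>. This is the factorisation
  \<open>\<sigma> = \<tau> \<circ> \<rho> \<circ> (l j)\<close> of \<open>bij_betw_factorisation\<close>; the pair \<open>(\<tau>, \<rho>)\<close> is arbitrary, because no
  forbidden pair mixes the two parts. The resulting recurrence
  \<open>r\<^sub>n\<^sub>+\<^sub>1 = r\<^sub>n + (\<Sum>k\<le>n. r\<^sub>k r\<^sub>n\<^sub>-\<^sub>k)\<close> is the one that the first return to the diagonal gives for
  Schroeder paths.

  The second is that the first and the last position never belong to a forbidden pair.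
  Exchanging their values is therefore an involution, and it exchanges the permutations with
  \<open>\<sigma> (n+1) < \<sigma> 1\<close> and those with \<open>\<sigma> 1 < \<sigma> (n+1)\<close>.
\<close>

section \<open>The recurrence for Schroeder paths\<close>

text \<open>Working with prefixes instead of truncations makes concatenation of paths easy to handle.\<close>

lemma schroeder_paths_iff_prefixes:
  "p \<in> schroeder_paths n \<longleftrightarrow>
     set p \<subseteq> {(1, 0), (0, 1), (1, 1)} \<and> sum_list p = (n, n) \<and>
     (\<forall>xs ys. p = xs @ ys \<longrightarrow> snd (sum_list xs) \<le> fst (sum_list xs))"
proof -
  have "(\<forall>k\<le>length p. snd (sum_list (take k p)) \<le> fst (sum_list (take k p))) \<longleftrightarrow>
        (\<forall>xs ys. p = xs @ ys \<longrightarrow> snd (sum_list xs) \<le> fst (sum_list xs))"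
    (is "?L \<longleftrightarrow> ?R")
  proof
    assume L: ?L
    show ?R
    proof (intro allI impI)
      fix xs ys assume "p = xs @ ys"
      then have "take (length xs) p = xs" "length xs \<le> length p" by auto
      with L show "snd (sum_list xs) \<le> fst (sum_list xs)" by metis
    qed
  next
    assume ?R
    then show ?L by (metis append_take_drop_id)
  qed
  then show ?thesis by (simp add: schroeder_paths_def)
qed

lemma schroeder_paths_0: "schroeder_paths 0 = {[]}"
proof
  show "schroeder_paths 0 \<subseteq> {[]}"
  proof
    fix p assume p: "p \<in> schroeder_paths 0"
    show "p \<in> {[]}"
    proof (cases p)
      case (Cons x xs)
      then show ?thesis
        using p by (auto simp: schroeder_paths_def zero_prod_def plus_prod_def)
    qed simp
  qed
qed (simp add: schroeder_paths_def zero_prod_def)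

lemma diagonal_step_path:
  "(1, 1) # p \<in> schroeder_paths (Suc n) \<longleftrightarrow> p \<in> schroeder_paths n"
proof -
  have "(\<forall>k\<le>Suc m. P k) \<longleftrightarrow> P 0 \<and> (\<forall>k\<le>m. P (Suc k))" for P m
    by (simp only: less_Suc_eq_le[symmetric] All_less_Suc2)
  then show ?thesis
    by (simp add: schroeder_paths_def) (simp add: prod_eq_iff)
qed

lemma append_Cons_eq_append_cases:
  assumes "q @ x # s = xs @ ys"
  obtains ws where "q = xs @ ws" | zs where "xs = q @ x # zs" "s = zs @ ys"
proof -
  from assms consider us where "q = xs @ us" | us where "xs = q @ us" "x # s = us @ ys"
    unfolding append_eq_append_conv2 by blast
  then show thesis
  proof cases
    case (2 us)
    then show ?thesis using that by (cases us) auto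
  qed (use that(1) in blast)
qed

text \<open>The step \<open>(0, 1)\<close> between \<open>q\<close> and \<open>s\<close> is the one with which the path returns to the diagonal
  for the first time.\<close>

lemma first_return_path:
  assumes "q \<in> schroeder_paths k" "s \<in> schroeder_paths m"
  shows "(1, 0) # q @ (0, 1) # s \<in> schroeder_paths (Suc (k + m))"
proof -
  have "snd (sum_list xs) \<le> fst (sum_list xs)"
    if "(1, 0) # q @ (0, 1) # s = xs @ ys" for xs ys
  proof (cases xs)
    case (Cons z zs)
    with that have z: "z = (1, 0)" and "q @ (0, 1) # s = zs @ ys" by auto
    from this(2) show ?thesis
    proof (cases rule: append_Cons_eq_append_cases)
      case (1 ws)
      then have "snd (sum_list zs) \<le> fst (sum_list zs)"
        using assms(1) unfolding schroeder_paths_iff_prefixes by blast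
      then show ?thesis by (simp add: Cons z)
    next
      case (2 ws)
      then have "snd (sum_list ws) \<le> fst (sum_list ws)"
        using assms(2) unfolding schroeder_paths_iff_prefixes by blast
      moreover have "sum_list q = (k, k)" using assms(1) by (simp add: schroeder_paths_def)
      ultimately show ?thesis by (simp add: Cons z 2(1))
    qed
  qed simp
  then show ?thesis
    using assms by (auto simp: schroeder_paths_iff_prefixes plus_prod_def)
qed

lemma first_return_exists:
  assumes p: "(1, 0) # p \<in> schroeder_paths (Suc n)"
  obtains k q s where "k \<le> n" "q \<in> schroeder_paths k" "s \<in> schroeder_paths (n - k)"
    "p = q @ (0, 1) # s"
proof -
  let ?above = "\<lambda>m. fst (sum_list (take m p)) < snd (sum_list (take m p))"
  have sum_p: "sum_list p = (n, Suc n)"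
    using p by (auto simp: schroeder_paths_def plus_prod_def prod_eq_iff)
  then have "?above (length p)" by simp
  then obtain m where m: "?above m" and below: "\<And>m'. m' < m \<Longrightarrow> \<not> ?above m'"
    using exists_least_iff[of ?above] by blast
  from m obtain m' where m': "m = Suc m'" by (cases m) auto
  have "m' < length p"
    using m below[of m'] m' by (cases "m' < length p") auto
  define q x s where "q = take m' p" and "x = p ! m'" and "s = drop m p"
  have split: "p = q @ x # s"
    using \<open>m' < length p\<close> by (simp add: q_def x_def s_def m' id_take_nth_drop)
  have "take m p = q @ [x]"
    using \<open>m' < length p\<close> by (simp add: q_def x_def m' take_Suc_conv_app_nth)
  moreover have "x \<in> {(1, 0), (0, 1), (1, 1)}" "set q \<subseteq> {(1, 0), (0, 1), (1, 1)}"
    "set s \<subseteq> {(1, 0), (0, 1), (1, 1)}"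
    using p split by (auto simp: schroeder_paths_def)
  moreover have q_below: "snd (sum_list q) \<le> fst (sum_list q)"
    using below[of m'] by (simp add: m' q_def)
  ultimately have x: "x = (0, 1)" and q_diag: "snd (sum_list q) = fst (sum_list q)"
    using m by auto
  define k where "k = fst (sum_list q)"
  have sum_q: "sum_list q = (k, k)"
    using q_diag by (simp add: k_def prod_eq_iff)
  have sum_s: "k \<le> n" "sum_list s = (n - k, n - k)"
    using sum_p sum_q by (cases "sum_list s"; simp add: split x; linarith)+
  have "snd (sum_list xs) \<le> fst (sum_list xs)" if "q = xs @ ys" for xs ys
  proof -
    have "length q = m'" using \<open>m' < length p\<close> by (simp add: q_def)
    then have "length xs < m" using that by (simp add: m')
    moreover have "take (length xs) p = xs" by (simp add: split that)
    ultimately show ?thesis using below[of "length xs"] by simp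
  qed
  moreover have "snd (sum_list xs) \<le> fst (sum_list xs)" if "s = xs @ ys" for xs ys
  proof -
    have "(1, 0) # p = ((1, 0) # q @ (0, 1) # xs) @ ys"
      using that by (simp add: split x)
    then have "snd (sum_list ((1, 0) # q @ (0, 1) # xs)) \<le> fst (sum_list ((1, 0) # q @ (0, 1) # xs))"
      using p unfolding schroeder_paths_iff_prefixes by blast
    then show ?thesis by (simp add: sum_q)
  qed
  ultimately have "q \<in> schroeder_paths k" "s \<in> schroeder_paths (n - k)"
    using \<open>set q \<subseteq> _\<close> \<open>set s \<subseteq> _\<close> sum_q sum_s by (auto simp: schroeder_paths_iff_prefixes)
  with that sum_s(1) split x show thesis by blast
qed

text \<open>If \<open>q\<close> were a proper prefix of \<open>q'\<close>, the next step of \<open>q'\<close> would lead above the diagonal.\<close>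

lemma first_return_unique:
  assumes "q \<in> schroeder_paths k" "q' \<in> schroeder_paths k'"
    and eq: "q @ (0, 1) # s = q' @ (0, 1) # s'"
  shows "k = k' \<and> q = q' \<and> s = s'"
proof -
  have no_extension: False
    if "a \<in> schroeder_paths c" "b \<in> schroeder_paths d" "b = a @ (0, 1) # ys" for a b c d ys
  proof -
    have "b = (a @ [(0, 1)]) @ ys" using that by simp
    then have "snd (sum_list (a @ [(0, 1)])) \<le> fst (sum_list (a @ [(0, 1)]))"
      using that(2) unfolding schroeder_paths_iff_prefixes by blast
    with that(1) show False by (simp add: schroeder_paths_def)
  qed
  consider "q = q'" "s = s'" | ys where "q' = q @ (0, 1) # ys" | ys where "q = q' @ (0, 1) # ys"
  proof (cases rule: append_Cons_eq_append_cases[OF eq])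
    case (1 ws)
    then show ?thesis using that(1,3) eq by (cases ws) auto
  qed (use that(2) in blast)
  then show ?thesis
  proof cases
    case 1
    then show ?thesis using assms by (auto simp: schroeder_paths_def)
  qed (use no_extension assms in blast)+
qed

lemma schroeder_paths_Suc:
  "schroeder_paths (Suc n) =
     (\<lambda>p. (1, 1) # p) ` schroeder_paths n \<union>
     (\<Union>k\<le>n. (\<lambda>(q, s). (1, 0) # q @ (0, 1) # s) ` (schroeder_paths k \<times> schroeder_paths (n - k)))"
  (is "_ = ?R")
proof
  show "?R \<subseteq> schroeder_paths (Suc n)"
  proof -
    have "(1, 0) # q @ (0, 1) # s \<in> schroeder_paths (Suc n)"
      if "k \<le> n" "q \<in> schroeder_paths k" "s \<in> schroeder_paths (n - k)" for k q s
      using first_return_path[OF that(2,3)] that(1) by simp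
    then show ?thesis using diagonal_step_path by auto
  qed
  show "schroeder_paths (Suc n) \<subseteq> ?R"
  proof
    fix p assume p: "p \<in> schroeder_paths (Suc n)"
    then obtain x p' where x: "p = x # p'"
      by (cases p) (auto simp: schroeder_paths_def zero_prod_def)
    have "x \<noteq> (0, 1)"
      using p unfolding schroeder_paths_iff_prefixes x
      by (auto dest: spec[of _ "[x]"])
    with p consider "x = (1, 1)" | "x = (1, 0)"
      by (auto simp: schroeder_paths_def x)
    then show "p \<in> ?R"
    proof cases
      case 1
      then show ?thesis using p x diagonal_step_path by blast
    next
      case 2
      with p x obtain k q s where "k \<le> n" "q \<in> schroeder_paths k" "s \<in> schroeder_paths (n - k)"
        "p' = q @ (0, 1) # s"
        using first_return_exists by metis
      then show ?thesis
        by (intro UnI2 UN_I[of k] image_eqI[of _ _ "(q, s)"]) (auto simp: x 2)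
    qed
  qed
qed

lemma finite_schroeder_paths: "finite (schroeder_paths n)"
proof (induction n rule: less_induct)
  case (less n)
  then show ?case
    by (cases n) (auto simp: schroeder_paths_0 schroeder_paths_Suc)
qed

lemma large_schroeder_0: "large_schroeder 0 = 1"
  by (simp add: large_schroeder_def schroeder_paths_0)

lemma large_schroeder_Suc:
  "large_schroeder (Suc n) =
     large_schroeder n + (\<Sum>k\<le>n. large_schroeder k * large_schroeder (n - k))"
proof -
  let ?f = "\<lambda>(q, s). (1, 0) # q @ (0, 1) # s :: (nat \<times> nat) list"
  let ?P = "\<lambda>k. schroeder_paths k \<times> schroeder_paths (n - k)"
  have inj: "inj_on ?f (?P k)" for k
  proof (rule inj_onI)
    fix x y
    assume "x \<in> ?P k" "y \<in> ?P k" "?f x = ?f y"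
    then show "x = y"
      using first_return_unique[of "fst x" k "fst y" k "snd x" "snd y"]
      by (simp add: case_prod_unfold mem_Times_iff prod_eq_iff)
  qed
  have disj: "?f ` ?P k \<inter> ?f ` ?P k' = {}" if "k \<noteq> k'" for k k'
  proof (rule ccontr)
    assume "?f ` ?P k \<inter> ?f ` ?P k' \<noteq> {}"
    then obtain q s q' s' where "q \<in> schroeder_paths k" "q' \<in> schroeder_paths k'"
      and "q @ (0, 1) # s = q' @ (0, 1) # s'" by auto
    then show False using first_return_unique that by blast
  qed
  have "card (schroeder_paths (Suc n)) =
      card ((\<lambda>p. (1, 1) # p) ` schroeder_paths n) + card (\<Union>k\<le>n. ?f ` ?P k)"
    unfolding schroeder_paths_Suc
    by (rule card_Un_disjoint) (auto simp: finite_schroeder_paths)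
  also have "card (\<Union>k\<le>n. ?f ` ?P k) = (\<Sum>k\<le>n. card (?f ` ?P k))"
    by (rule card_UN_disjoint) (use disj in \<open>auto simp: finite_schroeder_paths\<close>)
  also have "\<dots> = (\<Sum>k\<le>n. large_schroeder k * large_schroeder (n - k))"
    by (simp only: card_image[OF inj] card_cartesian_product large_schroeder_def)
  finally show ?thesis
    by (simp add: large_schroeder_def card_image)
qed

section \<open>Permutations of an interval without forbidden pairs\<close>

text \<open>A point fixed by \<open>\<sigma>\<close> never belongs to a forbidden pair. The condition can therefore range over
  all positions and be compared between permutations of different intervals.\<close>

definition no_forbidden_pair :: "(nat \<Rightarrow> nat) \<Rightarrow> bool" where
  "no_forbidden_pair \<sigma> \<longleftrightarrow> (\<forall>i k. i < k \<longrightarrow> \<sigma> k < i \<longrightarrow> \<sigma> i \<le> k)"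

definition good_perms :: "nat \<Rightarrow> nat \<Rightarrow> (nat \<Rightarrow> nat) set" where
  "good_perms l u = {\<sigma>. \<sigma> permutes {l..u} \<and> no_forbidden_pair \<sigma>}"

lemma finite_good_perms: "finite (good_perms l u)"
  by (rule finite_subset[OF _ finite_permutations[of "{l..u}"]]) (auto simp: good_perms_def)

lemma good_perms_singleton: "good_perms l l = {id}"
  by (auto simp: good_perms_def no_forbidden_pair_def)

lemma good_perms_fixing_least:
  assumes "l \<le> u"
  shows "{\<sigma> \<in> good_perms l u. \<sigma> l = l} = good_perms (Suc l) u"
proof -
  have "\<sigma> permutes {l..u} \<and> \<sigma> l = l \<longleftrightarrow> \<sigma> permutes {Suc l..u}" for \<sigma>
  proof
    assume "\<sigma> permutes {l..u} \<and> \<sigma> l = l"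
    then show "\<sigma> permutes {Suc l..u}"
      by (auto intro: permutes_superset simp: Suc_le_eq order.order_iff_strict)
  next
    assume "\<sigma> permutes {Suc l..u}"
    then show "\<sigma> permutes {l..u} \<and> \<sigma> l = l"
      by (auto intro: permutes_subset simp: permutes_not_in)
  qed
  then show ?thesis by (auto simp: good_perms_def)
qed

text \<open>An injection that misses a single value becomes a permutation by sending the additional
  point to this value.\<close>

lemma permutation_extending_injection:
  assumes "inj_on f A" "f ` A \<subseteq> insert j A" "j \<notin> A" "finite A"
  obtains \<tau> where "\<tau> permutes insert j A" "\<And>x. x \<in> A \<Longrightarrow> \<tau> x = f x"
proof -
  have "card (insert j A - f ` A) = 1"
    using assms by (subst card_Diff_subset) (auto simp: card_image)
  then obtain w where w: "insert j A - f ` A = {w}" by (auto simp: card_1_singleton_iff)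
  define \<tau> where "\<tau> x = (if x = j then w else if x \<in> A then f x else x)" for x
  have on_A: "\<tau> x = f x" if "x \<in> A" for x
    using that assms(3) by (auto simp: \<tau>_def)
  have "\<tau> ` A = f ` A" using on_A by (rule image_cong[OF refl])
  moreover have "\<tau> j = w" by (simp add: \<tau>_def)
  ultimately have "\<tau> ` insert j A = insert w (f ` A)" by simp
  also have "\<dots> = insert j A" using w assms(2) by blast
  finally have image: "\<tau> ` insert j A = insert j A" .
  then have "inj_on \<tau> (insert j A)"
    using assms(4) by (intro eq_card_imp_inj_on) simp_all
  with image have "bij_betw \<tau> (insert j A) (insert j A)"
    by (simp add: bij_betw_def)
  then have "\<tau> permutes insert j A"
    by (rule bij_imp_permutes) (auto simp: \<tau>_def)
  with on_A show thesis using that by blast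
qed

text \<open>A forbidden pair of the composition has both its positions strictly below \<open>j\<close> or both
  strictly above \<open>j\<close>. In the latter case the smaller value may be collapsed to \<open>j\<close> in \<open>\<rho>\<close>, which
  is still smaller than both positions.\<close>

lemma no_forbidden_pair_factorisation:
  assumes "l < j" "j \<le> u" and \<tau>: "\<tau> permutes {Suc l..j}" and \<rho>: "\<rho> permutes {j..u}"
  shows "no_forbidden_pair (\<tau> \<circ> \<rho> \<circ> transpose l j) \<longleftrightarrow> no_forbidden_pair \<tau> \<and> no_forbidden_pair \<rho>"
proof -
  define \<sigma> where "\<sigma> = \<tau> \<circ> \<rho> \<circ> transpose l j"
  have \<tau>_fix: "\<tau> x = x" if "x \<le> l \<or> j < x" for x
    using that by (intro permutes_not_in[OF \<tau>]) auto
  have \<rho>_fix: "\<rho> x = x" if "x < j \<or> u < x" for x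
    using that by (intro permutes_not_in[OF \<rho>]) auto
  have \<tau>_range: "l < \<tau> x \<and> \<tau> x \<le> j" if "l < x" "x \<le> j" for x
    using permutes_in_image[OF \<tau>, of x] that by auto
  have \<rho>_range: "j \<le> \<rho> x" if "j \<le> x" for x
    using permutes_in_image[OF \<rho>, of x] that \<rho>_fix[of x] by (cases "x \<le> u") auto
  have at_j: "\<sigma> j = l"
    using assms(1) by (simp add: \<sigma>_def \<tau>_fix \<rho>_fix)
  have below: "\<sigma> x = \<tau> x" if "l < x" "x < j" for x
    using that by (simp add: \<sigma>_def \<rho>_fix transpose_def)
  have above: "\<sigma> x = \<tau> (\<rho> x)" if "j < x" for x
    using that assms(1) by (simp add: \<sigma>_def transpose_def)
  have above_large: "\<sigma> x = \<rho> x" if "j < x" "j < \<rho> x" for x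
    using that by (simp add: above \<tau>_fix)
  have above_j: "l < \<sigma> x \<and> \<sigma> x \<le> j" if "j < x" "\<rho> x = j" for x
    using that assms(1) by (simp add: above \<tau>_range)
  have outside_below: "\<sigma> x = x" if "x < l" for x
    using that assms(1) by (simp add: \<sigma>_def \<tau>_fix \<rho>_fix transpose_def)
  have \<sigma>_ge: "l \<le> \<sigma> x" if "l < x" for x
    using that at_j below[of x] \<tau>_range[of x] above_large[of x] above_j[of x] \<rho>_range[of x]
      assms(1)
    by (cases x j rule: linorder_cases; cases "\<rho> x = j") auto
  have at_l: "l \<le> \<sigma> l"
    using \<rho>_range[of j] \<tau>_range[of j] \<tau>_fix[of "\<rho> j"] assms(1)
    by (cases "\<rho> j = j") (auto simp: \<sigma>_def)
  have "no_forbidden_pair \<tau>" if \<sigma>: "no_forbidden_pair \<sigma>"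
    unfolding no_forbidden_pair_def
  proof (intro allI impI)
    fix i k assume "i < k" "\<tau> k < i"
    show "\<tau> i \<le> k"
    proof (rule ccontr)
      assume "\<not> \<tau> i \<le> k"
      with \<open>i < k\<close> have i: "l < i" "i \<le> j" using \<tau>_fix[of i] by (force simp: not_le)+
      then have "k < j" using \<open>\<not> \<tau> i \<le> k\<close> \<tau>_range[of i] by auto
      then show False
        using \<sigma>[unfolded no_forbidden_pair_def, rule_format, of i k] below[of i] below[of k] i
          \<open>i < k\<close> \<open>\<tau> k < i\<close> \<open>\<not> \<tau> i \<le> k\<close> by simp
    qed
  qed
  moreover have "no_forbidden_pair \<rho>" if \<sigma>: "no_forbidden_pair \<sigma>"
    unfolding no_forbidden_pair_def
  proof (intro allI impI)
    fix i k assume "i < k" "\<rho> k < i"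
    have "j \<le> k" using \<open>i < k\<close> \<open>\<rho> k < i\<close> \<rho>_fix[of k] by force
    then have "j < i" "j < k" using \<open>i < k\<close> \<open>\<rho> k < i\<close> \<rho>_range[of k] by auto
    show "\<rho> i \<le> k"
    proof (rule ccontr)
      assume "\<not> \<rho> i \<le> k"
      with \<open>j < k\<close> \<open>j < i\<close> have "\<sigma> i = \<rho> i" using above_large by auto
      moreover have "\<sigma> k < i"
        using \<open>\<rho> k < i\<close> \<open>j < k\<close> \<open>j < i\<close> above_large[of k] above_j[of k] \<rho>_range[of k]
        by (cases "\<rho> k = j") auto
      ultimately show False
        using \<sigma>[unfolded no_forbidden_pair_def, rule_format, of i k] \<open>i < k\<close> \<open>\<not> \<rho> i \<le> k\<close> by simp
    qed
  qed
  moreover have "no_forbidden_pair \<sigma>" if nf: "no_forbidden_pair \<tau>" "no_forbidden_pair \<rho>"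
    unfolding no_forbidden_pair_def
  proof (intro allI impI)
    fix i k assume "i < k" "\<sigma> k < i"
    have "l < i"
      using \<open>i < k\<close> \<open>\<sigma> k < i\<close> outside_below[of k] at_l \<sigma>_ge[of k]
      by (cases k l rule: linorder_cases) auto
    consider "k < j" | "i < j" "j \<le> k" | "i = j" | "j < i" by linarith
    then show "\<sigma> i \<le> k"
    proof cases
      case 1
      then show ?thesis
        using nf(1) below[of i] below[of k] \<open>l < i\<close> \<open>i < k\<close> \<open>\<sigma> k < i\<close>
        by (auto simp: no_forbidden_pair_def)
    next
      case 2
      then show ?thesis using below[of i] \<tau>_range[of i] \<open>l < i\<close> by auto
    next
      case 3
      then show ?thesis using at_j assms(1) \<open>i < k\<close> by auto
    next
      case 4
      then have "\<rho> k < i"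
        using above_large[of k] \<rho>_range[of k] \<open>i < k\<close> \<open>\<sigma> k < i\<close> by (cases "\<rho> k = j") auto
      then have "\<rho> i \<le> k"
        using nf(2) \<open>i < k\<close> by (auto simp: no_forbidden_pair_def)
      then show ?thesis
        using 4 above_large[of i] above_j[of i] \<rho>_range[of i] \<open>i < k\<close> by (cases "\<rho> i = j") auto
    qed
  qed
  ultimately show ?thesis unfolding \<sigma>_def by blast
qed

lemma bij_betw_factorisation:
  assumes "l < j" "j \<le> u"
  shows "bij_betw (\<lambda>(\<tau>, \<rho>). \<tau> \<circ> \<rho> \<circ> transpose l j)
           (good_perms (Suc l) j \<times> good_perms j u) {\<sigma> \<in> good_perms l u. \<sigma> j = l}"
  unfolding bij_betw_def
proof (intro conjI)
  let ?F = "\<lambda>(\<tau>, \<rho>). \<tau> \<circ> \<rho> \<circ> transpose l j"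
  \<comment> \<open>The supports of the two factors share only the point \<open>j\<close>, so the quotient of two
    factorisations is a permutation of \<open>{j}\<close>.\<close>
  show "inj_on ?F (good_perms (Suc l) j \<times> good_perms j u)"
  proof (rule inj_onI, clarsimp simp: good_perms_def)
    fix \<tau> \<rho> \<tau>' \<rho>'
    assume \<tau>: "\<tau> permutes {Suc l..j}" and \<rho>: "\<rho> permutes {j..u}"
      and \<tau>': "\<tau>' permutes {Suc l..j}" and \<rho>': "\<rho>' permutes {j..u}"
      and "\<tau> \<circ> \<rho> \<circ> transpose l j = \<tau>' \<circ> \<rho>' \<circ> transpose l j"
    then have "(\<tau> \<circ> \<rho>) \<circ> (transpose l j \<circ> transpose l j) = (\<tau>' \<circ> \<rho>') \<circ> (transpose l j \<circ> transpose l j)"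
      by (metis comp_assoc)
    then have eq: "\<tau> (\<rho> x) = \<tau>' (\<rho>' x)" for x by (simp add: fun_eq_iff)
    have agree: "\<tau> x = \<tau>' x" if "x \<noteq> j" for x
    proof (cases "x < j")
      case True
      then show ?thesis
        using eq[of x] permutes_not_in[OF \<rho>, of x] permutes_not_in[OF \<rho>', of x] by simp
    next
      case False
      then show ?thesis
        using that permutes_not_in[OF \<tau>, of x] permutes_not_in[OF \<tau>', of x] by simp
    qed
    have "inv \<tau>' \<circ> \<tau> permutes {Suc l..j}"
      by (intro permutes_compose permutes_inv \<tau> \<tau>')
    moreover have "(inv \<tau>' \<circ> \<tau>) x = x" if "x \<noteq> j" for x
      using agree[OF that] permutes_inverses(2)[OF \<tau>'] by simp
    ultimately have "inv \<tau>' \<circ> \<tau> permutes {j}"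
      by (intro permutes_superset[of _ "{Suc l..j}" "{j}"]) auto
    then have "inv \<tau>' \<circ> \<tau> = id" by simp
    then have "\<tau> = \<tau>'"
      by (metis \<tau>' comp_assoc comp_id id_comp permutes_inv_o(1))
    moreover from this have "\<rho> = \<rho>'"
      using eq permutes_inj[OF \<tau>'] by (auto simp: inj_def)
    ultimately show "\<tau> = \<tau>' \<and> \<rho> = \<rho>'" ..
  qed
  show "?F ` (good_perms (Suc l) j \<times> good_perms j u) = {\<sigma> \<in> good_perms l u. \<sigma> j = l}"
  proof (intro equalityI subsetI)
    fix \<sigma> assume "\<sigma> \<in> ?F ` (good_perms (Suc l) j \<times> good_perms j u)"
    then obtain \<tau> \<rho> where \<sigma>: "\<sigma> = \<tau> \<circ> \<rho> \<circ> transpose l j"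
      and \<tau>: "\<tau> permutes {Suc l..j}" "no_forbidden_pair \<tau>"
      and \<rho>: "\<rho> permutes {j..u}" "no_forbidden_pair \<rho>"
      by (auto simp: good_perms_def)
    have "\<tau> permutes {l..u}" "\<rho> permutes {l..u}" "transpose l j permutes {l..u}"
      using assms by (auto intro: permutes_subset[OF \<tau>(1)] permutes_subset[OF \<rho>(1)] permutes_swap_id)
    then have "\<sigma> permutes {l..u}" unfolding \<sigma> by (intro permutes_compose)
    moreover have "\<sigma> j = l"
      using assms permutes_not_in[OF \<tau>(1), of l] permutes_not_in[OF \<rho>(1), of l] by (simp add: \<sigma>)
    ultimately show "\<sigma> \<in> {\<sigma> \<in> good_perms l u. \<sigma> j = l}"
      using no_forbidden_pair_factorisation[OF assms \<tau>(1) \<rho>(1)] \<tau>(2) \<rho>(2)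
      by (simp add: good_perms_def \<sigma>)
  next
    fix \<sigma> assume "\<sigma> \<in> {\<sigma> \<in> good_perms l u. \<sigma> j = l}"
    then have \<sigma>: "\<sigma> permutes {l..u}" "no_forbidden_pair \<sigma>" "\<sigma> j = l"
      by (auto simp: good_perms_def)
    define A where "A = {Suc l..<j}"
    have insert_A: "insert j A = {Suc l..j}" using assms by (auto simp: A_def)
    have "\<sigma> x \<in> {Suc l..j}" if "x \<in> A" for x
    proof -
      have x: "l < x" "x < j" using that by (auto simp: A_def)
      then have "\<sigma> x \<noteq> \<sigma> j" using permutes_inj[OF \<sigma>(1)] by (auto simp: inj_def)
      moreover have "l \<le> \<sigma> x" using permutes_in_image[OF \<sigma>(1), of x] x assms by simp
      ultimately show ?thesis
        using \<sigma>(2,3) x by (auto simp: no_forbidden_pair_def)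
    qed
    then have "\<sigma> ` A \<subseteq> insert j A" unfolding insert_A by blast
    moreover have "inj_on \<sigma> A" using permutes_inj[OF \<sigma>(1)] by (rule inj_on_subset) simp
    ultimately obtain \<tau> where "\<tau> permutes insert j A" and \<tau>_eq: "\<And>x. x \<in> A \<Longrightarrow> \<tau> x = \<sigma> x"
      using permutation_extending_injection[of \<sigma> A j] by (auto simp: A_def)
    then have \<tau>: "\<tau> permutes {Suc l..j}" by (simp only: insert_A)
    define \<rho> where "\<rho> = inv \<tau> \<circ> \<sigma> \<circ> transpose l j"
    have "inv \<tau> permutes {l..u}" "transpose l j permutes {l..u}"
      using assms by (auto intro: permutes_subset[OF permutes_inv[OF \<tau>]] permutes_swap_id)
    then have "\<rho> permutes {l..u}"
      unfolding \<rho>_def using \<sigma>(1) by (intro permutes_compose)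
    moreover have "\<rho> x = x" if "x \<in> {l..u} - {j..u}" for x
    proof (cases "x = l")
      case True
      then show ?thesis
        using assms \<sigma>(3) permutes_not_in[OF permutes_inv[OF \<tau>], of l] by (simp add: \<rho>_def)
    next
      case False
      with that have "x \<in> A" "x \<noteq> j" by (auto simp: A_def)
      then show ?thesis
        using False \<tau>_eq[of x, symmetric] permutes_inverses(2)[OF \<tau>] by (simp add: \<rho>_def transpose_def)
    qed
    ultimately have \<rho>: "\<rho> permutes {j..u}" by (intro permutes_superset[of _ "{l..u}" "{j..u}"]) auto
    have \<sigma>_eq: "\<sigma> = \<tau> \<circ> \<rho> \<circ> transpose l j"
      by (simp add: fun_eq_iff \<rho>_def permutes_inverses(1)[OF \<tau>])
    have "no_forbidden_pair \<tau>" "no_forbidden_pair \<rho>"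
      using no_forbidden_pair_factorisation[OF assms \<tau> \<rho>] \<sigma>(2) \<sigma>_eq by auto
    with \<tau> \<rho> \<sigma>_eq show "\<sigma> \<in> ?F ` (good_perms (Suc l) j \<times> good_perms j u)"
      by (intro image_eqI[of _ _ "(\<tau>, \<rho>)"]) (auto simp: good_perms_def)
  qed
qed

lemma card_good_perms_recurrence:
  assumes "l < u"
  shows "card (good_perms l u) =
     card (good_perms (Suc l) u) + (\<Sum>j\<in>{Suc l..u}. card (good_perms (Suc l) j) * card (good_perms j u))"
proof -
  let ?B = "\<lambda>j. {\<sigma> \<in> good_perms l u. \<sigma> j = l}"
  have "good_perms l u = (\<Union>j\<in>{l..u}. ?B j)"
  proof -
    have "\<exists>j\<in>{l..u}. \<sigma> j = l" if "\<sigma> \<in> good_perms l u" for \<sigma>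
    proof -
      have "l \<in> \<sigma> ` {l..u}"
        using that assms permutes_image[of \<sigma> "{l..u}"] by (auto simp: good_perms_def)
      then show ?thesis by force
    qed
    then show ?thesis by auto
  qed
  also have "card \<dots> = (\<Sum>j\<in>{l..u}. card (?B j))"
  proof (rule card_UN_disjoint)
    have "j = j'" if "\<sigma> \<in> good_perms l u" "\<sigma> j = l" "\<sigma> j' = l" for \<sigma> j j'
    proof -
      have "inj \<sigma>" using that(1) by (auto simp: good_perms_def dest: permutes_inj)
      then show ?thesis using that by (simp add: inj_def)
    qed
    then show "\<forall>j\<in>{l..u}. \<forall>j'\<in>{l..u}. j \<noteq> j' \<longrightarrow> ?B j \<inter> ?B j' = {}" by blast
  qed (simp_all add: finite_good_perms)
  also have "\<dots> = card (?B l) + (\<Sum>j\<in>{Suc l..u}. card (?B j))"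
    using assms by (simp add: sum.atLeast_Suc_atMost)
  also have "card (?B l) = card (good_perms (Suc l) u)"
    using assms by (simp add: good_perms_fixing_least)
  also have "(\<Sum>j\<in>{Suc l..u}. card (?B j)) =
      (\<Sum>j\<in>{Suc l..u}. card (good_perms (Suc l) j) * card (good_perms j u))"
  proof (rule sum.cong)
    fix j assume "j \<in> {Suc l..u}"
    then have "card (good_perms (Suc l) j \<times> good_perms j u) = card (?B j)"
      by (intro bij_betw_same_card[OF bij_betw_factorisation]) auto
    then show "card (?B j) = card (good_perms (Suc l) j) * card (good_perms j u)"
      by (simp add: card_cartesian_product)
  qed simp
  finally show ?thesis .
qed

lemma card_good_perms: "card (good_perms l (l + n)) = large_schroeder n"
proof (induction n arbitrary: l rule: less_induct)
  case (less n)
  show ?case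
  proof (cases n)
    case 0
    then show ?thesis by (simp add: good_perms_singleton large_schroeder_0)
  next
    case (Suc m)
    have "(\<Sum>j\<in>{Suc l..l + n}. card (good_perms (Suc l) j) * card (good_perms j (l + n))) =
        (\<Sum>k\<le>m. card (good_perms (Suc l) (Suc l + k)) * card (good_perms (Suc l + k) (Suc l + m)))"
      by (rule sum.reindex_bij_witness[of _ "\<lambda>k. Suc l + k" "\<lambda>j. j - Suc l"]) (auto simp: Suc)
    also have "\<dots> = (\<Sum>k\<le>m. large_schroeder k * large_schroeder (m - k))"
    proof (rule sum.cong)
      fix k assume "k \<in> {..m}"
      then show "card (good_perms (Suc l) (Suc l + k)) * card (good_perms (Suc l + k) (Suc l + m)) =
          large_schroeder k * large_schroeder (m - k)"
        using less[of k "Suc l"] less[of "m - k" "Suc l + k"] by (simp add: Suc)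
    qed simp
    finally show ?thesis
      using card_good_perms_recurrence[of l "l + n"] less[of m "Suc l"]
      by (simp add: Suc large_schroeder_Suc)
  qed
qed

section \<open>Exchanging the values at the two ends\<close>

lemma no_forbidden_pair_swap_ends:
  assumes "\<sigma> permutes {l..u}" "no_forbidden_pair \<sigma>" "l \<le> u"
  shows "no_forbidden_pair (\<sigma> \<circ> transpose l u)"
  unfolding no_forbidden_pair_def
proof (intro allI impI, rule ccontr)
  let ?\<sigma> = "\<sigma> \<circ> transpose l u"
  fix i k assume ik: "i < k" "?\<sigma> k < i" "\<not> ?\<sigma> i \<le> k"
  have perm: "?\<sigma> permutes {l..u}"
    using assms by (intro permutes_compose permutes_swap_id) auto
  have "k \<in> {l..u}" "i \<in> {l..u}"
    using ik permutes_not_in[OF perm, of k] permutes_not_in[OF perm, of i] by force+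
  then have "l \<le> ?\<sigma> k" "?\<sigma> i \<le> u"
    using permutes_in_image[OF perm] by auto
  \<comment> \<open>A forbidden pair leaves room for a value below \<open>i\<close> and a value above \<open>k\<close>, so neither
    position is an end point and the transposition moves neither of them.\<close>
  then have "transpose l u i = i" "transpose l u k = k"
    using ik by (auto simp: transpose_def)
  then show False
    using ik assms(2) by (auto simp: no_forbidden_pair_def)
qed

lemma card_good_perms_descending_ends:
  assumes "l < u"
  shows "2 * card {\<sigma> \<in> good_perms l u. \<sigma> u < \<sigma> l} = card (good_perms l u)"
proof -
  let ?D = "{\<sigma> \<in> good_perms l u. \<sigma> u < \<sigma> l}" and ?E = "{\<sigma> \<in> good_perms l u. \<sigma> l < \<sigma> u}"
  have swap: "\<sigma> \<circ> transpose l u \<in> good_perms l u" if "\<sigma> \<in> good_perms l u" for \<sigma>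
    using that assms no_forbidden_pair_swap_ends
    by (auto simp: good_perms_def intro!: permutes_compose permutes_swap_id)
  have "bij_betw (\<lambda>\<sigma>. \<sigma> \<circ> transpose l u) ?D ?E"
    by (rule bij_betw_byWitness[where f' = "\<lambda>\<sigma>. \<sigma> \<circ> transpose l u"])
      (use swap in \<open>auto simp: comp_assoc\<close>)
  then have "card ?D = card ?E" by (rule bij_betw_same_card)
  moreover have "card (?D \<union> ?E) = card ?D + card ?E"
    by (rule card_Un_disjoint) (auto simp: finite_good_perms)
  moreover have "?D \<union> ?E = good_perms l u"
  proof -
    have "\<sigma> l \<noteq> \<sigma> u" if "\<sigma> \<in> good_perms l u" for \<sigma>
    proof -
      have "inj \<sigma>" using that by (auto simp: good_perms_def dest: permutes_inj)
      then show ?thesis using assms by (auto simp: inj_def)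
    qed
    then show ?thesis by (auto simp: neq_iff)
  qed
  ultimately show ?thesis by simp
qed

section \<open>Smooth collections and their permutations\<close>

lemma smooth_collection_eq_image:
  assumes S: "smooth_collection n S" and \<pi>: "attached_perm n S \<pi>" and "1 \<le> m" "m \<le> n"
  shows "S m = \<pi> ` {1..m}"
proof -
  have "extend_collection n S m = \<pi> ` {1..m}" if "m \<le> n" for m
    using that
  proof (induction m)
    case 0
    then show ?case by (simp add: extend_collection_def)
  next
    case (Suc m)
    have "extend_collection n S m \<subseteq> extend_collection n S (Suc m)"
      using S Suc.prems by (auto simp: extend_collection_def smooth_collection_def)
    moreover have "{\<pi> (Suc m)} = extend_collection n S (Suc m) - extend_collection n S m"
      using \<pi> Suc.prems by (force simp: attached_perm_def)
    ultimately have "extend_collection n S (Suc m) = insert (\<pi> (Suc m)) (extend_collection n S m)"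
      by blast
    then show ?case using Suc by (simp add: atLeastAtMostSuc_conv)
  qed
  from this[OF assms(4)] show ?thesis
    using assms(3,4) by (simp add: extend_collection_def)
qed

lemma mem_image_initial_segment_iff:
  assumes "\<pi> permutes {1..N}" "x \<in> {1..N}"
  shows "x \<in> \<pi> ` {1..m} \<longleftrightarrow> inv \<pi> x \<le> m"
proof -
  have "x \<in> \<pi> ` {1..m} \<longleftrightarrow> inv \<pi> x \<in> {1..m}"
    using permutes_inverses[OF assms(1)] by (metis image_iff)
  moreover have "inv \<pi> x \<ge> 1"
    using permutes_in_image[OF permutes_inv[OF assms(1)], of x] assms(2) by simp
  ultimately show ?thesis by simp
qed

lemma smooth_perms_eq:
  "smooth_perms n = {\<pi>. \<pi> permutes {1..n+1} \<and>
     (\<forall>a b. 1 \<le> a \<and> a < b \<and> b \<le> n \<longrightarrow> inv \<pi> b \<le> a \<longrightarrow> inv \<pi> (a + 1) \<le> b)}"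
proof (intro equalityI subsetI)
  fix \<pi> assume "\<pi> \<in> smooth_perms n"
  then obtain S where S: "smooth_collection n S" "attached_perm n S \<pi>"
    by (auto simp: smooth_perms_def)
  then have perm: "\<pi> permutes {1..n+1}" by (simp add: attached_perm_def)
  have mem: "x \<in> S m \<longleftrightarrow> inv \<pi> x \<le> m" if "x \<in> {1..n+1}" "1 \<le> m" "m \<le> n" for x m
    using smooth_collection_eq_image[OF S, of m] mem_image_initial_segment_iff[OF perm, of x m] that
    by auto
  have "inv \<pi> (a + 1) \<le> b" if "1 \<le> a \<and> a < b \<and> b \<le> n" "inv \<pi> b \<le> a" for a b
    using that S(1) mem[of b a] mem[of "a + 1" b] by (auto simp: smooth_collection_def)
  with perm show "\<pi> \<in> {\<pi>. \<pi> permutes {1..n+1} \<and>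
     (\<forall>a b. 1 \<le> a \<and> a < b \<and> b \<le> n \<longrightarrow> inv \<pi> b \<le> a \<longrightarrow> inv \<pi> (a + 1) \<le> b)}" by blast
next
  fix \<pi> assume "\<pi> \<in> {\<pi>. \<pi> permutes {1..n+1} \<and>
     (\<forall>a b. 1 \<le> a \<and> a < b \<and> b \<le> n \<longrightarrow> inv \<pi> b \<le> a \<longrightarrow> inv \<pi> (a + 1) \<le> b)}"
  then have perm: "\<pi> permutes {1..n+1}" and cond:
    "\<And>a b. 1 \<le> a \<Longrightarrow> a < b \<Longrightarrow> b \<le> n \<Longrightarrow> inv \<pi> b \<le> a \<Longrightarrow> inv \<pi> (a + 1) \<le> b" by auto
  have inj: "inj \<pi>" using perm by (rule permutes_inj)
  define S where "S m = \<pi> ` {1..m}" for m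
  have "S a \<subseteq> {1..n+1}" if "a \<le> n" for a
    using permutes_in_image[OF perm] that by (auto simp: S_def simp del: One_nat_def)
  moreover have "card (S a) = a" for a
    using inj by (simp add: S_def card_image inj_on_subset)
  moreover have "S a \<subset> S (a + 1)" for a
    unfolding S_def by (rule image_strict_mono[OF inj_on_subset[OF inj]]) auto
  moreover have "a + 1 \<in> S b" if "1 \<le> a \<and> a < b \<and> b \<le> n" "b \<in> S a" for a b
    using that cond[of a b] mem_image_initial_segment_iff[OF perm, of b a]
      mem_image_initial_segment_iff[OF perm, of "a + 1" b] by (auto simp: S_def)
  ultimately have "smooth_collection n S" unfolding smooth_collection_def by auto
  moreover have extend: "extend_collection n S m = \<pi> ` {1..m}" if "m \<le> n + 1" for m
  proof (cases "m \<le> n")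
    case False
    with that have "m = n + 1" by simp
    then show ?thesis using permutes_image[OF perm] by (simp add: extend_collection_def)
  qed (simp add: extend_collection_def S_def)
  have "{\<pi> m} = extend_collection n S m - extend_collection n S (m - 1)" if "m \<in> {1..n+1}" for m
  proof -
    have "\<pi> ` {1..m} - \<pi> ` {1..m - 1} = \<pi> ` ({1..m} - {1..m - 1})"
      using inj by (simp add: image_set_diff)
    also have "{1..m} - {1..m - 1} = {m}" using that by auto
    finally show ?thesis
      using that extend[of m] extend[of "m - 1"] by (auto simp: le_diff_conv)
  qed
  then have "attached_perm n S \<pi>" using perm by (simp add: attached_perm_def)
  ultimately show "\<pi> \<in> smooth_perms n" by (auto simp: smooth_perms_def)
qed

text \<open>The indices of a forbidden pair lie in the range required by the condition on smooth
  collections, with \<open>i = a + 1\<close> and \<open>k = b\<close>.\<close>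

lemma no_forbidden_pair_iff:
  assumes "\<sigma> permutes {1..n+1}"
  shows "no_forbidden_pair \<sigma> \<longleftrightarrow>
    (\<forall>a b. 1 \<le> a \<and> a < b \<and> b \<le> n \<longrightarrow> \<sigma> b \<le> a \<longrightarrow> \<sigma> (a + 1) \<le> b)"
proof
  assume nf: "no_forbidden_pair \<sigma>"
  show "\<forall>a b. 1 \<le> a \<and> a < b \<and> b \<le> n \<longrightarrow> \<sigma> b \<le> a \<longrightarrow> \<sigma> (a + 1) \<le> b"
  proof (intro allI impI)
    fix a b assume ab: "1 \<le> a \<and> a < b \<and> b \<le> n" "\<sigma> b \<le> a"
    show "\<sigma> (a + 1) \<le> b"
    proof (cases "a + 1 = b")
      case False
      then have "a + 1 < b" using ab by simp
      then show ?thesis using nf ab by (auto simp: no_forbidden_pair_def)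
    qed (use ab in simp)
  qed
next
  assume cond: "\<forall>a b. 1 \<le> a \<and> a < b \<and> b \<le> n \<longrightarrow> \<sigma> b \<le> a \<longrightarrow> \<sigma> (a + 1) \<le> b"
  show "no_forbidden_pair \<sigma>"
    unfolding no_forbidden_pair_def
  proof (intro allI impI, rule ccontr)
    fix i k assume ik: "i < k" "\<sigma> k < i" "\<not> \<sigma> i \<le> k"
    have "k \<in> {1..n+1}" "i \<in> {1..n+1}"
      using ik permutes_not_in[OF assms, of k] permutes_not_in[OF assms, of i] by force+
    then have "1 \<le> \<sigma> k" "\<sigma> i \<le> n + 1"
      using permutes_in_image[OF assms] by auto
    moreover obtain a where "i = a + 1"
      using ik by (cases i) auto
    ultimately show False
      using ik cond[rule_format, of a k] by simp
  qed
qed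

lemma bij_betw_inv_smooth_perms: "bij_betw inv (smooth_perms n) (good_perms 1 (1 + n))"
proof (rule bij_betw_byWitness[where f' = inv])
  show "\<forall>\<pi>\<in>smooth_perms n. inv (inv \<pi>) = \<pi>" "\<forall>\<sigma>\<in>good_perms 1 (1 + n). inv (inv \<sigma>) = \<sigma>"
    by (auto simp: smooth_perms_eq good_perms_def permutes_inv_inv)
  show "inv ` smooth_perms n \<subseteq> good_perms 1 (1 + n)"
  proof clarify
    fix \<pi> assume "\<pi> \<in> smooth_perms n"
    moreover from this have "inv \<pi> permutes {1..n+1}"
      by (simp add: smooth_perms_eq permutes_inv)
    ultimately show "inv \<pi> \<in> good_perms 1 (1 + n)"
      using no_forbidden_pair_iff by (simp add: smooth_perms_eq good_perms_def)
  qed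
  show "inv ` good_perms 1 (1 + n) \<subseteq> smooth_perms n"
  proof clarify
    fix \<sigma> assume \<sigma>: "\<sigma> \<in> good_perms 1 (1 + n)"
    then have "inv \<sigma> permutes {1..n+1}" "\<sigma> permutes {1..n+1}" "inv (inv \<sigma>) = \<sigma>"
      by (auto simp: good_perms_def permutes_inv permutes_inv_inv)
    then show "inv \<sigma> \<in> smooth_perms n"
      using \<sigma> no_forbidden_pair_iff by (simp add: smooth_perms_eq good_perms_def)
  qed
qed

theorem corollary4p12:
  fixes n :: nat
  assumes "n \<ge> 1"
  shows "smooth_perms n =
           {\<pi>. \<pi> permutes {1..n+1} \<and>
                (\<forall>a b. 1 \<le> a \<and> a < b \<and> b \<le> n \<longrightarrow> inv \<pi> b \<le> a \<longrightarrow> inv \<pi> (a + 1) \<le> b)} \<and>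
         card (smooth_perms n) = large_schroeder n \<and>
         of_nat (card {\<pi> \<in> smooth_perms n. inv \<pi> (n + 1) < inv \<pi> 1}) = small_schroeder n"
proof (intro conjI)
  have card_eq: "card (good_perms 1 (1 + n)) = large_schroeder n"
    by (rule card_good_perms)
  show "card (smooth_perms n) = large_schroeder n"
    using bij_betw_same_card[OF bij_betw_inv_smooth_perms] card_eq by simp
  let ?D = "{\<pi> \<in> smooth_perms n. inv \<pi> (n + 1) < inv \<pi> 1}"
  have "inj_on inv ?D"
    using bij_betw_imp_inj_on[OF bij_betw_inv_smooth_perms[of n]] by (rule inj_on_subset) blast
  then have "card ?D = card (inv ` ?D)" by (simp only: card_image)
  also have "inv ` ?D = {\<sigma> \<in> inv ` smooth_perms n. \<sigma> (1 + n) < \<sigma> 1}"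
    unfolding add.commute[of n 1] by blast
  finally have "card ?D = card {\<sigma> \<in> good_perms 1 (1 + n). \<sigma> (1 + n) < \<sigma> 1}"
    by (simp only: bij_betw_imp_surj_on[OF bij_betw_inv_smooth_perms])
  then have "large_schroeder n = 2 * card ?D"
    using card_good_perms_descending_ends[of 1 "1 + n"] assms card_eq by simp
  then show "of_nat (card ?D) = small_schroeder n"
    by (simp add: small_schroeder_def)
qed (rule smooth_perms_eq)

end
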